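(* Let $f\in\mathcal{C}_{\mathrm{lune}}$. Then $$|H_{2,1}(F_f/2)|\le \frac{23}{3264}.$$ The inequality is sharp: equality holds for the function $h\in\mathcal{C}_{\mathrm{lune}}$ given by $$h(z)=\int_0^z\frac{h_0(x)}{x}\,dx=z+\frac{\sqrt{69}}{12\sqrt{17}}z^3+\frac{1}{20}\left(\frac{69}{136}+\frac{\sqrt{69}}{4\sqrt{17}}\right)z^5+\cdots,\qquad z\in\mathbb{D},$$ where $$h_0(z)=z\exp\left(\sqrt{\frac{69}{68}}\int_0^z\frac{x^2+\sqrt{1+x^4}-1}{x}\,dx\right).$$
   Context: $\mathbb{D}=\{z\in\mathbb{C}:|z|<1\}$. $\mathcal{S}$ is the class of univalent (injective holomorphic) functions on $\mathbb{D}$ of the form $f(z)=z+\sum_{n\ge2}a_nz^n$. For analytic functions $F,G$ on $\mathbb{D}$, $F\prec G$ ($F$ is subordinate to $G$) means that there is an analytic $w:\mathbb{D}\to\mathbb{D}$ with $w(0)=0$ and $F(z)=G(w(z))$ for all $z\in\mathbb{D}$. Let $q(z)=z+\sqrt{1+z^2}$ for $z\in\mathbb{D}$, with the branch of the square root chosen so that $q(0)=1$. The class of convex functions associated with the lune is $$\mathcal{C}_{\mathrm{lune}}=\left\{f\in\mathcal{S}:\ 1+\frac{zf''(z)}{f'(z)}\prec q(z)\right\}.$$ The square root $\sqrt{1+x^4}$ in the definition of $h_0$ is likewise the branch equal to $1$ at $x=0$. For $f\in\mathcal{S}$, the logarithmic coefficients $\gamma_n=\gamma_n(f)$ are defined by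 $$F_f(z)=\log\frac{f(z)}{z}=2\sum_{n=1}^\infty\gamma_n z^n,\qquad \log 1=0,$$ and $$H_{2,1}(F_f/2)=\gamma_1\gamma_3-\gamma_2^2=\frac{1}{48}\left(a_2^4-12a_3^2+12a_2a_4\right).$$
   Formalization: The claim h ∈ C_lune is false (1+zh''/h' → 1+√(69/68)·√2 > 1+√2 as z→1, but |q|<1+√2); instead h is shown to lie in S with the stated expansion and equality value, and sharpness is proved by the existence of another function in C_lune attaining 23/3264. *)

theory Defs
  imports "HOL-Complex_Analysis.Complex_Analysis"
begin

abbreviation unit_disc :: "complex set"  (\<open>\<D>\<close>) where
  "\<D> \<equiv> ball 0 1"

definition class_S :: "(complex \<Rightarrow> complex) set" where
  "class_S = {f. f holomorphic_on \<D> \<and> inj_on f \<D> \<and> f 0 = 0 \<and> deriv f 0 = 1}"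

definition subordinate :: "(complex \<Rightarrow> complex) \<Rightarrow> (complex \<Rightarrow> complex) \<Rightarrow> bool"  (infix \<open>\<prec>\<^sub>s\<close> 50) where
  "F \<prec>\<^sub>s G \<longleftrightarrow>
     (\<exists>w. w holomorphic_on \<D> \<and> w ` \<D> \<subseteq> \<D> \<and> w 0 = 0 \<and> (\<forall>z\<in>\<D>. F z = G (w z)))"

(* For z in the disc, 1 + z^2 lies in the right half-plane, so the principal root csqrt is the
   holomorphic branch with value 1 at z = 0. *)
definition lune_q :: "complex \<Rightarrow> complex" where
  "lune_q z = z + csqrt (1 + z ^ 2)"

definition C_lune :: "(complex \<Rightarrow> complex) set" where
  "C_lune = {f \<in> class_S. (\<lambda>z. 1 + z * deriv (deriv f) z / deriv f z) \<prec>\<^sub>s lune_q}"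

(* The branch on the disc of log (f z / z) vanishing at 0.  For f in class S it exists and is
   unique on the disc; the values of log_quot f outside the disc play no role. *)
definition log_quot :: "(complex \<Rightarrow> complex) \<Rightarrow> complex \<Rightarrow> complex" where
  "log_quot f = (SOME F. F holomorphic_on \<D> \<and> F 0 = 0 \<and> (\<forall>z\<in>\<D> - {0}. exp (F z) = f z / z))"

definition log_coeff :: "(complex \<Rightarrow> complex) \<Rightarrow> nat \<Rightarrow> complex" where
  "log_coeff f n = fps_nth (fps_expansion (log_quot f) 0) n / 2"

definition H21_log :: "(complex \<Rightarrow> complex) \<Rightarrow> complex" where
  "H21_log f = log_coeff f 1 * log_coeff f 3 - (log_coeff f 2) ^ 2"

(* The integrands below have removable singularities at 0; the value 0 given to them there by
   division by zero does not affect the integrals.  As in lune_q, csqrt is the branch of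
   sqrt (1 + x^4) with value 1 at x = 0. *)
definition lune_h0 :: "complex \<Rightarrow> complex" where
  "lune_h0 z = z * exp (complex_of_real (sqrt (69 / 68)) *
     contour_integral (linepath 0 z) (\<lambda>x. (x ^ 2 + csqrt (1 + x ^ 4) - 1) / x))"

(* This function is in class S but not in C_lune: members of C_lune with vanishing z^2 coefficient
   have z^3 coefficient of modulus at most 1/6, while here it is sqrt (69/68) / 6. *)
definition lune_h :: "complex \<Rightarrow> complex" where
  "lune_h z = contour_integral (linepath 0 z) (\<lambda>x. lune_h0 x / x)"

end

theory Submission
  imports Defs
begin

text \<open>
  If 1 + z f'' / f' = q(w(z)) with w(z) = c1 z + c2 z^2 + ..., comparing coefficients gives
  48 H = - c1^4 / 16 + c1^2 c2 / 4 - c2^2 / 3 + c1 c3 / 2. Two steps of Schur's algorithm write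
  c2 = (1 - |c1|^2) x and c3 = (1 - |c1|^2) (y - cnj c1 x^2) with |x| \<le> 1 and |y| \<le> 1 - |x|^2.
  The triangle inequality leaves a majorant in |c1| and |x| that increases in |x|, and at |x| = 1
  it is a quadratic in |c1|^2 with maximum 23/68 at |c1|^2 = 2/17. All terms align for c1 > 0 and
  x = -1, that is for w(z) = z (c1 - z) / (1 - c1 z).

  Univalence of the functions constructed below is elementary: f' = exp g, where z g'(z) is
  bounded by A |z| + B |z|^2 with A + B/2 \<le> 3/2 < pi/2, so that |Im g| < pi/2 and Re f' > 0.
\<close>

unbundle no vec_syntax

subsection \<open>Power series and logarithmic coefficients\<close>

lemma holomorphic_has_fps_expansion:
  assumes "f holomorphic_on \<D>"
  shows "f has_fps_expansion fps_expansion f 0"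
  using has_fps_expansion_fps_expansion[OF _ _ assms] by auto

text \<open>The bridge used throughout: a functional identity on the disc becomes an identity of
  formal power series, whose coefficients can then be compared.\<close>

lemma has_fps_expansion_eq_on_disc:
  fixes F G :: "complex fps"
  assumes "f has_fps_expansion F" "g has_fps_expansion G" "\<And>z. z \<in> \<D> \<Longrightarrow> f z = g z"
  shows "F = G"
proof -
  have "eventually (\<lambda>z. z \<in> \<D>) (nhds (0::complex))"
    by (intro eventually_nhds_in_open) auto
  then have "eventually (\<lambda>z. f z = g z) (nhds 0)"
    by (rule eventually_mono) (use assms(3) in auto)
  then have "f has_fps_expansion G"
    using has_fps_expansion_cong[of f g G G] assms(2) by simp
  with assms(1) show ?thesis
    by (rule fps_expansion_unique_complex)
qed

lemma fps_expansion_deriv: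
  "fps_expansion (deriv f) 0 = fps_deriv (fps_expansion f 0)"
  by (rule fps_ext) (simp add: fps_expansion_def funpow_Suc_right del: funpow.simps of_nat_Suc)

lemma deriv_holomorphic_on_disc:
  "f holomorphic_on \<D> \<Longrightarrow> deriv f holomorphic_on \<D>"
  by (rule holomorphic_deriv) auto

lemma fps_expansion_nth_0 [simp]: "fps_nth (fps_expansion f 0) 0 = f 0"
  and fps_expansion_nth_Suc_0 [simp]: "fps_nth (fps_expansion f 0) (Suc 0) = deriv f 0"
  by (simp_all add: fps_expansion_def)

text \<open>Dividing out the zero at 0 removes the singularity of f(z)/z. The quotient has no zeros:
  away from 0 by injectivity and f(0) = 0, and at 0 because its value there is f'(0) = 1.\<close>

lemma class_S_quotient:
  assumes "f \<in> class_S"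
  obtains h where "h holomorphic_on \<D>" "h 0 = 1" "\<And>z. z \<in> \<D> \<Longrightarrow> f z = z * h z"
    "\<And>z. z \<in> \<D> \<Longrightarrow> h z \<noteq> 0"
proof -
  have f: "f holomorphic_on \<D>" "inj_on f \<D>" "f 0 = 0" "deriv f 0 = 1"
    using assms by (auto simp: class_S_def)
  obtain h where h: "h holomorphic_on \<D>" "\<And>z. norm z < 1 \<Longrightarrow> f z = z * h z" "deriv f 0 = h 0"
    using Schwarz3[OF f(1,3)] by metis
  have "h z \<noteq> 0" if "z \<in> \<D>" for z
  proof (cases "z = 0")
    case False
    then have "f z \<noteq> f 0"
      using inj_onD[OF f(2), of z 0] that by auto
    then show ?thesis
      using h(2)[of z] that f(3) by auto
  qed (use h(3) f(4) in auto)
  then show ?thesis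
    using that[of h] h f by auto
qed

text \<open>\<open>log_quot\<close> is a choice, so a witness is needed: the zero-free quotient has
  a holomorphic logarithm on the convex disc, and subtracting its value at 0 normalizes it, since
  the quotient is 1 there.\<close>

lemma log_quot_properties:
  assumes "f \<in> class_S"
  shows "log_quot f holomorphic_on \<D>" "log_quot f 0 = 0"
    "\<And>z. z \<in> \<D> - {0} \<Longrightarrow> exp (log_quot f z) = f z / z"
proof -
  obtain h where h: "h holomorphic_on \<D>" "h 0 = 1" "\<And>z. z \<in> \<D> \<Longrightarrow> f z = z * h z"
    "\<And>z. z \<in> \<D> \<Longrightarrow> h z \<noteq> 0"
    using class_S_quotient[OF assms] by blast
  obtain g where g: "g holomorphic_on \<D>" "\<And>x. x \<in> \<D> \<Longrightarrow> exp (g x) = h x"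
    using holomorphic_logarithm_exists[OF convex_ball open_ball h(1,4), of 0] by auto
  have "(\<lambda>z. g z - g 0) holomorphic_on \<D> \<and> g 0 - g 0 = 0 \<and>
      (\<forall>z\<in>\<D> - {0}. exp (g z - g 0) = f z / z)"
    using g h by (auto intro!: holomorphic_intros simp: exp_diff)
  then have "\<exists>F. F holomorphic_on \<D> \<and> F 0 = 0 \<and> (\<forall>z\<in>\<D> - {0}. exp (F z) = f z / z)"
    by fast
  then have "log_quot f holomorphic_on \<D> \<and> log_quot f 0 = 0 \<and>
      (\<forall>z\<in>\<D> - {0}. exp (log_quot f z) = f z / z)"
    unfolding log_quot_def by (rule someI_ex)
  then show "log_quot f holomorphic_on \<D>" "log_quot f 0 = 0"
    "\<And>z. z \<in> \<D> - {0} \<Longrightarrow> exp (log_quot f z) = f z / z"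
    by auto
qed

text \<open>Differentiating exp L = f(z)/z =: h gives h' = L' h. This is linear in the coefficients
  of L, so they are found recursively without expanding the exponential.\<close>

lemma H21_log_eq:
  assumes "f \<in> class_S"
  defines "a \<equiv> fps_nth (fps_expansion f 0)"
  shows "48 * H21_log f = a 2 ^ 4 - 12 * a 3 ^ 2 + 12 * a 2 * a 4"
proof -
  obtain h where h: "h holomorphic_on \<D>" "h 0 = 1" "\<And>z. z \<in> \<D> \<Longrightarrow> f z = z * h z"
    "\<And>z. z \<in> \<D> \<Longrightarrow> h z \<noteq> 0"
    using class_S_quotient[OF assms(1)] by blast
  define L where "L = log_quot f"
  note L = log_quot_properties[OF assms(1), folded L_def]
  have f: "f holomorphic_on \<D>"
    using assms by (auto simp: class_S_def)
  define A G M where "A = fps_expansion f 0" and "G = fps_expansion h 0"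
    and "M = fps_expansion L 0"
  have "A = fps_X * G"
    by (rule has_fps_expansion_eq_on_disc[OF holomorphic_has_fps_expansion[OF f, folded A_def]
          has_fps_expansion_mult[OF has_fps_expansion_fps_X
            holomorphic_has_fps_expansion[OF h(1), folded G_def]]])
       (rule h(3))
  then have A: "A $ Suc n = G $ n" for n
    by simp
  \<comment> \<open>At 0 the term \<open>f z / z\<close> is 0 by the convention for division by
    zero, so there the identity rests on \<open>L 0 = 0\<close> and \<open>h 0 = 1\<close>
    instead.\<close>
  have expL: "exp (L z) = h z" if "z \<in> \<D>" for z
    using L(2) L(3)[of z] h(2) h(3)[of z] that by (cases "z = 0") auto
  have dh: "deriv h z = deriv L z * h z" if "z \<in> \<D>" for z
  proof -
    have "((\<lambda>z. exp (L z)) has_field_derivative exp (L z) * deriv L z) (at z)"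
      by (rule DERIV_chain2[OF DERIV_exp holomorphic_derivI[OF L(1) open_ball that]])
    moreover have "((\<lambda>z. exp (L z)) has_field_derivative deriv h z) (at z)"
      using holomorphic_derivI[OF h(1) open_ball that]
      by (rule has_field_derivative_transform_within_open[where S = \<D>]) (use that expL in auto)
    ultimately have "exp (L z) * deriv L z = deriv h z"
      by (rule DERIV_unique)
    then show ?thesis
      using expL[OF that] by (simp add: mult.commute)
  qed
  have "fps_deriv G = fps_deriv M * G"
    unfolding G_def M_def fps_expansion_deriv[symmetric]
    by (rule has_fps_expansion_eq_on_disc[OF holomorphic_has_fps_expansion
          has_fps_expansion_mult[OF holomorphic_has_fps_expansion holomorphic_has_fps_expansion]])
       (use h L dh in \<open>auto intro: deriv_holomorphic_on_disc\<close>)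
  then have *: "fps_deriv G $ n = (fps_deriv M * G) $ n" for n
    by simp
  have "G $ 0 = 1"
    using h(2) by (simp add: G_def)
  with *[of 0] *[of 1] *[of 2] have
    "G $ 1 = M $ 1" "2 * G $ 2 = 2 * M $ 2 + M $ 1 * G $ 1"
    "3 * G $ 3 = 3 * M $ 3 + 2 * M $ 2 * G $ 1 + M $ 1 * G $ 2"
    by (simp_all add: fps_mult_nth numeral_2_eq_2 numeral_3_eq_3 algebra_simps)
  moreover have "a 2 = G $ 1" "a 3 = G $ 2" "a 4 = G $ 3"
    using A by (simp_all add: a_def A_def[symmetric] eval_nat_numeral)
  \<comment> \<open>\<open>M $ n\<close> is twice the n-th logarithmic coefficient.\<close>
  ultimately have M: "M $ 1 = a 2" "M $ 2 = a 3 - a 2 ^ 2 / 2"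
    "M $ 3 = a 4 - a 2 * a 3 + a 2 ^ 3 / 3"
    by (simp_all add: field_simps power2_eq_square power3_eq_cube)
  then show ?thesis
    unfolding H21_log_def log_coeff_def L_def[symmetric] M_def[symmetric] M
    by (simp add: field_simps power2_eq_square power3_eq_cube power4_eq_xxxx)
qed

subsection \<open>Coefficients of Schwarz functions\<close>

text \<open>Maximum modulus principle. It settles the degenerate case of Schur's algorithm, where
  the Moebius map required for the next step does not exist.\<close>

lemma bounded_const_if_unimodular:
  assumes \<phi>: "\<phi> holomorphic_on \<D>" "\<And>z. z \<in> \<D> \<Longrightarrow> norm (\<phi> z) \<le> 1"
    and z: "z \<in> \<D>" "norm (\<phi> z) = 1"
  obtains c where "\<And>z. z \<in> \<D> \<Longrightarrow> \<phi> z = c"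
proof -
  have "\<phi> constant_on \<D>"
    by (rule maximum_modulus_principle[OF \<phi>(1), of \<D> z]) (use \<phi>(2) z in auto)
  then show ?thesis
    using that by (auto simp: constant_on_def)
qed

text \<open>Follow \<phi> by the disc automorphism that moves \<phi>(0) to 0 and divide by z;
  Schwarz's lemma bounds the quotient \<psi> by 1. The denominator of the automorphism is cleared so
  that the relation carries over to power series.\<close>

lemma Schur_step:
  assumes \<phi>: "\<phi> holomorphic_on \<D>" "\<And>z. z \<in> \<D> \<Longrightarrow> norm (\<phi> z) \<le> 1" and c: "norm (\<phi> 0) < 1"
  obtains \<psi> where "\<psi> holomorphic_on \<D>" "\<And>z. z \<in> \<D> \<Longrightarrow> norm (\<psi> z) \<le> 1"
    "\<And>z. z \<in> \<D> \<Longrightarrow> \<phi> z - \<phi> 0 = z * \<psi> z * (1 - cnj (\<phi> 0) * \<phi> z)"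
proof -
  \<comment> \<open>A value of modulus 1 would force \<phi> to be constant, contradicting
    |\<phi>(0)| < 1.\<close>
  have lt: "norm (\<phi> z) < 1" if z: "z \<in> \<D>" for z
  proof (rule ccontr)
    assume "\<not> norm (\<phi> z) < 1"
    with \<phi>(2)[OF z] have "norm (\<phi> z) = 1" by simp
    then obtain k where k: "\<And>z. z \<in> \<D> \<Longrightarrow> \<phi> z = k"
      using bounded_const_if_unimodular[OF \<phi> z] by blast
    have "\<phi> z = \<phi> 0" using k[OF z] k[of 0] by simp
    with c \<open>norm (\<phi> z) = 1\<close> show False by simp
  qed
  define m where "m = Moebius_function 0 (\<phi> 0) \<circ> \<phi>"
  have m_hol: "m holomorphic_on \<D>"
    unfolding m_def
    by (rule holomorphic_on_compose_gen[OF \<phi>(1) Moebius_function_holomorphic[OF c]])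
       (use lt in auto)
  have m0: "m 0 = 0"
    by (simp add: m_def Moebius_function_eq_zero)
  have m_lt: "norm (m z) < 1" if "norm z < 1" for z
    unfolding m_def o_def by (rule Moebius_function_norm_lt_1) (use c lt that in auto)
  obtain \<psi> where \<psi>: "\<psi> holomorphic_on \<D>" "\<And>z. norm z < 1 \<Longrightarrow> m z = z * \<psi> z" "deriv m 0 = \<psi> 0"
    using Schwarz3[OF m_hol m0] by metis
  have "norm (\<psi> z) \<le> 1" if "z \<in> \<D>" for z
  proof (cases "z = 0")
    case True
    then show ?thesis
      using Schwarz_Lemma(2)[OF m_hol m0 m_lt, of 0] \<psi>(3) by simp
  next
    case False
    then show ?thesis
      using Schwarz_Lemma(1)[OF m_hol m0 m_lt, of z] \<psi>(2)[of z] that by (simp add: norm_mult)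
  qed
  moreover have "\<phi> z - \<phi> 0 = z * \<psi> z * (1 - cnj (\<phi> 0) * \<phi> z)" if "z \<in> \<D>" for z
  proof -
    have "norm (cnj (\<phi> 0) * \<phi> z) < 1"
      using mult_strict_mono[OF c lt[OF that]] by (simp add: norm_mult)
    then have "1 - cnj (\<phi> 0) * \<phi> z \<noteq> 0"
      by auto
    then show ?thesis
      using \<psi>(2)[of z] that by (simp add: m_def Moebius_function_simple field_simps)
  qed
  ultimately show ?thesis
    using that \<psi>(1) by blast
qed

lemma Schur_step_fps:
  assumes "\<phi> holomorphic_on \<D>" "\<psi> holomorphic_on \<D>"
    "\<And>z. z \<in> \<D> \<Longrightarrow> \<phi> z - \<phi> 0 = z * \<psi> z * (1 - cnj (\<phi> 0) * \<phi> z)"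
  defines "a \<equiv> fps_nth (fps_expansion \<phi> 0)" and "b \<equiv> fps_nth (fps_expansion \<psi> 0)"
  shows "a 1 = b 0 * (1 - cnj (a 0) * a 0)"
    and "a 2 = b 1 * (1 - cnj (a 0) * a 0) - cnj (a 0) * b 0 * a 1"
proof -
  have "fps_expansion \<phi> 0 - fps_const (\<phi> 0) =
      fps_X * fps_expansion \<psi> 0 * (1 - fps_const (cnj (\<phi> 0)) * fps_expansion \<phi> 0)"
    using assms(3)
    by (intro has_fps_expansion_eq_on_disc[where f = "\<lambda>z. \<phi> z - \<phi> 0"
          and g = "\<lambda>z. z * \<psi> z * (1 - cnj (\<phi> 0) * \<phi> z)"] fps_expansion_intros
          holomorphic_has_fps_expansion assms(1,2))
  then have *: "(fps_expansion \<phi> 0 - fps_const (\<phi> 0)) $ Suc n =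
      (fps_expansion \<psi> 0 * (1 - fps_const (cnj (\<phi> 0)) * fps_expansion \<phi> 0)) $ n" for n
    by (simp add: mult.assoc)
  show "a 1 = b 0 * (1 - cnj (a 0) * a 0)"
    using *[of 0] by (simp add: a_def b_def)
  show "a 2 = b 1 * (1 - cnj (a 0) * a 0) - cnj (a 0) * b 0 * a 1"
    using *[of 1] by (simp add: a_def b_def numeral_2_eq_2 algebra_simps)
qed

lemma fps_expansion_const_on_disc:
  assumes "\<phi> holomorphic_on \<D>" "\<And>z. z \<in> \<D> \<Longrightarrow> \<phi> z = c"
  shows "fps_expansion \<phi> 0 = fps_const c"
  using has_fps_expansion_eq_on_disc[OF holomorphic_has_fps_expansion[OF assms(1)]
      has_fps_expansion_const assms(2)] .

text \<open>One Schur step gives the first coefficient as \<psi>(0) (1 - |\<phi>(0)|^2) with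
  |\<psi>(0)| \<le> 1; if |\<phi>(0)| = 1, the function is constant.\<close>

lemma norm_coeff_1_bounded:
  assumes \<phi>: "\<phi> holomorphic_on \<D>" "\<And>z. z \<in> \<D> \<Longrightarrow> norm (\<phi> z) \<le> 1"
  shows "norm (fps_nth (fps_expansion \<phi> 0) 1) \<le> 1 - (norm (\<phi> 0))\<^sup>2"
proof (cases "norm (\<phi> 0) = 1")
  case True
  then obtain c where "\<And>z. z \<in> \<D> \<Longrightarrow> \<phi> z = c"
    using bounded_const_if_unimodular[OF \<phi>, of 0] by auto
  then have "fps_expansion \<phi> 0 = fps_const c"
    by (rule fps_expansion_const_on_disc[OF \<phi>(1)])
  then show ?thesis
    using True by simp
next
  case False
  with \<phi>(2)[of 0] have c: "norm (\<phi> 0) < 1" by simp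
  obtain \<psi> where \<psi>: "\<psi> holomorphic_on \<D>" "\<And>z. z \<in> \<D> \<Longrightarrow> norm (\<psi> z) \<le> 1"
    "\<And>z. z \<in> \<D> \<Longrightarrow> \<phi> z - \<phi> 0 = z * \<psi> z * (1 - cnj (\<phi> 0) * \<phi> z)"
    using Schur_step[OF \<phi> c] by blast
  have "1 - cnj (\<phi> 0) * \<phi> 0 = of_real (1 - (norm (\<phi> 0))\<^sup>2)"
    by (metis complex_norm_square mult.commute of_real_1 of_real_diff)
  then have "norm (fps_nth (fps_expansion \<phi> 0) 1) = norm (\<psi> 0) * \<bar>1 - (norm (\<phi> 0))\<^sup>2\<bar>"
    using Schur_step_fps(1)[OF \<phi>(1) \<psi>(1,3)]
    by (simp add: norm_mult del: of_real_diff)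
  also have "\<dots> \<le> 1 * \<bar>1 - (norm (\<phi> 0))\<^sup>2\<bar>"
    by (intro mult_right_mono \<psi>) auto
  also have "\<dots> = 1 - (norm (\<phi> 0))\<^sup>2"
    using c by (simp add: abs_square_le_1)
  finally show ?thesis .
qed

text \<open>Schur's algorithm is applied to w(z)/z, whose coefficients are those of w shifted by
  one. The parameters x and y are the first two coefficients of the next Schur function, and a
  further Schur step bounds y.\<close>

lemma Schwarz_function_coeffs:
  assumes w: "w holomorphic_on \<D>" "w ` \<D> \<subseteq> \<D>" "w 0 = 0"
  defines "c \<equiv> fps_nth (fps_expansion w 0)"
  obtains x y where "norm (c 1) \<le> 1" "norm x \<le> 1" "norm y \<le> 1 - (norm x)\<^sup>2"
    "c 2 = complex_of_real (1 - (norm (c 1))\<^sup>2) * x"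
    "c 3 = complex_of_real (1 - (norm (c 1))\<^sup>2) * (y - cnj (c 1) * x\<^sup>2)"
proof -
  obtain \<phi> where \<phi>: "\<phi> holomorphic_on \<D>" "\<And>z. norm z < 1 \<Longrightarrow> w z = z * \<phi> z" "deriv w 0 = \<phi> 0"
    using Schwarz3[OF w(1,3)] by metis
  have w_lt: "norm (w z) < 1" if "norm z < 1" for z
    using w(2) that by (auto simp: image_subset_iff)
  have \<phi>_le: "norm (\<phi> z) \<le> 1" if "z \<in> \<D>" for z
  proof (cases "z = 0")
    case True
    then show ?thesis
      using Schwarz_Lemma(2)[OF w(1,3) w_lt, of 0] \<phi>(3) by simp
  next
    case False
    then show ?thesis
      using Schwarz_Lemma(1)[OF w(1,3) w_lt, of z] \<phi>(2)[of z] that by (simp add: norm_mult)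
  qed
  define a where "a = fps_nth (fps_expansion \<phi> 0)"
  have "fps_expansion w 0 = fps_X * fps_expansion \<phi> 0"
    by (rule has_fps_expansion_eq_on_disc[OF holomorphic_has_fps_expansion[OF w(1)]
          has_fps_expansion_mult[OF has_fps_expansion_fps_X holomorphic_has_fps_expansion[OF \<phi>(1)]]])
       (use \<phi>(2) in auto)
  then have c: "c 1 = a 0" "c 2 = a 1" "c 3 = a 2"
    by (simp_all add: c_def a_def)
  have a0: "a 0 = \<phi> 0"
    by (simp add: a_def)
  have le: "norm (c 1) \<le> 1"
    using \<phi>_le[of 0] unfolding c a0 by simp
  show ?thesis
  proof (cases "norm (\<phi> 0) = 1")
    case True
    then obtain k where "\<And>z. z \<in> \<D> \<Longrightarrow> \<phi> z = k"
      using bounded_const_if_unimodular[OF \<phi>(1) \<phi>_le, of 0] by auto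
    then have "fps_expansion \<phi> 0 = fps_const k"
      by (rule fps_expansion_const_on_disc[OF \<phi>(1)])
    then have "a 1 = 0" "a 2 = 0"
      unfolding a_def by simp_all
    then show ?thesis
      \<comment> \<open>If |c1| = 1, then w is a rotation and c2 = c3 = 0. The factor 1 - |c1|^2
        vanishes, so x = y = 0 will do.\<close>
      using that[of 0 0] le c by (simp add: a0 True)
  next
    case False
    with \<phi>_le[of 0] have "norm (\<phi> 0) < 1" by simp
    then obtain \<psi> where \<psi>: "\<psi> holomorphic_on \<D>" "\<And>z. z \<in> \<D> \<Longrightarrow> norm (\<psi> z) \<le> 1"
      "\<And>z. z \<in> \<D> \<Longrightarrow> \<phi> z - \<phi> 0 = z * \<psi> z * (1 - cnj (\<phi> 0) * \<phi> z)"
      using Schur_step[OF \<phi>(1) \<phi>_le] by blast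
    define b where "b = fps_nth (fps_expansion \<psi> 0)"
    have norm_sq: "1 - complex_of_real ((norm (a 0))\<^sup>2) = 1 - cnj (a 0) * a 0"
      by (simp add: complex_norm_square mult.commute del: of_real_power)
    note ab = Schur_step_fps[OF \<phi>(1) \<psi>(1,3), folded a_def b_def]
    have a1: "a (Suc 0) = (1 - cnj (a 0) * a 0) * b 0"
      using ab(1) by (simp add: mult.commute)
    have a2: "a 2 = (1 - cnj (a 0) * a 0) * (b 1 - cnj (a 0) * (b 0)\<^sup>2)"
      using ab(2) by (simp add: a1 algebra_simps power2_eq_square)
    show ?thesis
    proof (rule that[of "b 0" "b 1"])
      show "norm (b 0) \<le> 1"
        using \<psi>(2)[of 0] by (simp add: b_def)
      show "norm (b 1) \<le> 1 - (norm (b 0))\<^sup>2"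
        using norm_coeff_1_bounded[OF \<psi>(1,2)] by (simp add: b_def)
      show "c 2 = complex_of_real (1 - (norm (c 1))\<^sup>2) * b 0"
        unfolding c of_real_diff of_real_1 norm_sq using a1 by simp
      show "c 3 = complex_of_real (1 - (norm (c 1))\<^sup>2) * (b 1 - cnj (c 1) * (b 0)\<^sup>2)"
        unfolding c of_real_diff of_real_1 norm_sq by (rule a2)
    qed (rule le)
  qed
qed

section \<open>The sharp estimate of the coefficient functional\<close>

lemma real_majorant_le:
  fixes r t :: real
  assumes r: "0 \<le> r" "r \<le> 1" and t: "0 \<le> t" "t \<le> 1"
  shows "r ^ 4 / 16 + r\<^sup>2 * (1 - r\<^sup>2) * t / 4 + (1 - r\<^sup>2) * (2 + r\<^sup>2) * t\<^sup>2 / 6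
      + r * (1 - r\<^sup>2) * (1 - t\<^sup>2) / 2 \<le> 23 / 68"
proof -
  have "0 \<le> 1 - r\<^sup>2" "t\<^sup>2 \<le> 1"
    using r t by (simp_all add: power_le_one)
  moreover have "0 \<le> r\<^sup>2 * (1 - r\<^sup>2)"
    using r by (simp add: power_le_one)
  \<comment> \<open>The total coefficient of t^2 in the majorant is (1 - r^2) (1 - r) (2 - r) / 6,
    from (2 + r^2)/6 - r/2. It is nonnegative, as is that of t, so t may be replaced by 1.\<close>
  ultimately have "r\<^sup>2 * (1 - r\<^sup>2) * t \<le> r\<^sup>2 * (1 - r\<^sup>2) * 1"
    "(1 - r\<^sup>2) * ((1 - r) * (2 - r)) * t\<^sup>2 \<le> (1 - r\<^sup>2) * ((1 - r) * (2 - r)) * 1"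
    using r t by (intro mult_left_mono mult_nonneg_nonneg; simp)+
  then have "r ^ 4 / 16 + r\<^sup>2 * (1 - r\<^sup>2) * t / 4 + (1 - r\<^sup>2) * (2 + r\<^sup>2) * t\<^sup>2 / 6
      + r * (1 - r\<^sup>2) * (1 - t\<^sup>2) / 2
      \<le> r ^ 4 / 16 + r\<^sup>2 * (1 - r\<^sup>2) / 4 + (1 - r\<^sup>2) * (2 + r\<^sup>2) / 6"
    by (simp add: field_simps power2_eq_square power4_eq_xxxx)
  \<comment> \<open>Completing the square in r^2: the left side is 1/3 + r^2/12 - 17 r^4/48.\<close>
  also have "\<dots> = 23 / 68 - 17 / 48 * (r\<^sup>2 - 2 / 17)\<^sup>2"
    by (simp add: field_simps power2_eq_square power4_eq_xxxx)
  also have "\<dots> \<le> 23 / 68"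
    by simp
  finally show ?thesis .
qed

lemma Schwarz_functional_le:
  assumes w: "w holomorphic_on \<D>" "w ` \<D> \<subseteq> \<D>" "w 0 = 0"
  defines "c \<equiv> fps_nth (fps_expansion w 0)"
  shows "norm (- (c 1 ^ 4 / 16) + (c 1)\<^sup>2 * c 2 / 4 - (c 2)\<^sup>2 / 3 + c 1 * c 3 / 2) \<le> 23 / 68"
proof -
  obtain x y where xy: "norm (c 1) \<le> 1" "norm x \<le> 1" "norm y \<le> 1 - (norm x)\<^sup>2"
    "c 2 = complex_of_real (1 - (norm (c 1))\<^sup>2) * x"
    "c 3 = complex_of_real (1 - (norm (c 1))\<^sup>2) * (y - cnj (c 1) * x\<^sup>2)"
    using Schwarz_function_coeffs[OF w] unfolding c_def by metis
  define r t S where "r = norm (c 1)" and "t = norm x" and "S = 1 - r\<^sup>2"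
  have S: "0 \<le> S"
    using xy(1) by (simp add: S_def r_def power_le_one)
  have c2: "c 2 = of_real S * x" and c3: "c 3 = of_real S * (y - cnj (c 1) * x\<^sup>2)"
    using xy by (simp_all add: S_def r_def)
  have cc: "c 1 * cnj (c 1) = of_real (1 - S)"
    by (simp add: S_def r_def complex_norm_square[symmetric])
  have c13: "c 1 * c 3 = of_real S * (c 1 * y - of_real (1 - S) * x\<^sup>2)"
    unfolding c3 cc[symmetric] by (simp add: algebra_simps)
  \<comment> \<open>The x^2 terms of c2^2 and c1 c3 are merged before the triangle inequality. Since
    c1 \<open>cnj\<close> c1 = 1 - S is real, they add up to the single term -S (3 - S) x^2 / 6,
    where 3 - S = 2 + r^2.\<close>
  have "- (c 1 ^ 4 / 16) + (c 1)\<^sup>2 * c 2 / 4 - (c 2)\<^sup>2 / 3 + c 1 * c 3 / 2 =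
      - (c 1 ^ 4 / 16) + (c 1)\<^sup>2 * of_real S * x / 4 - of_real (S * (3 - S) / 6) * x\<^sup>2
      + c 1 * of_real S * y / 2"
    unfolding c13 c2 by (simp add: field_simps power2_eq_square)
  also have "norm \<dots> \<le> norm (c 1 ^ 4 / 16) + norm ((c 1)\<^sup>2 * of_real S * x / 4)
      + norm (of_real (S * (3 - S) / 6) * x\<^sup>2) + norm (c 1 * of_real S * y / 2)"
    by (rule order_trans[OF norm_triangle_ineq] order_trans[OF norm_triangle_ineq4] add_mono order_refl)+
       simp_all
  also have "norm (c 1 ^ 4 / 16) = r ^ 4 / 16"
    by (simp add: norm_divide norm_power r_def)
  also have "norm ((c 1)\<^sup>2 * of_real S * x / 4) = r\<^sup>2 * S * t / 4"
    using S by (simp add: norm_divide norm_mult norm_power r_def t_def)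
  also have "norm (of_real (S * (3 - S) / 6) * x\<^sup>2) = S * (2 + r\<^sup>2) * t\<^sup>2 / 6"
  proof -
    have "S * (3 - S) / 6 = S * (2 + r\<^sup>2) / 6" "0 \<le> S * (3 - S) / 6"
      using S by (simp_all add: S_def)
    then show ?thesis
      by (simp only: norm_mult norm_of_real norm_power t_def abs_of_nonneg) simp
  qed
  also have "norm (c 1 * of_real S * y / 2) \<le> r * S * (1 - t\<^sup>2) / 2"
  proof -
    have "norm (c 1 * of_real S * y / 2) = r * S * norm y / 2"
      using S by (simp add: norm_mult norm_divide r_def)
    also have "\<dots> \<le> r * S * (1 - t\<^sup>2) / 2"
      using xy(3) S by (intro divide_right_mono mult_left_mono) (auto simp: r_def t_def)
    finally show ?thesis .
  qed
  also have "r ^ 4 / 16 + r\<^sup>2 * S * t / 4 + S * (2 + r\<^sup>2) * t\<^sup>2 / 6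
      + r * S * (1 - t\<^sup>2) / 2 \<le> 23 / 68"
    unfolding S_def by (rule real_majorant_le) (use xy in \<open>auto simp: r_def t_def\<close>)
  finally show ?thesis
    by simp
qed

subsection \<open>The lune and the pre-Schwarzian equation\<close>

lemma lune_radicand:
  assumes "z \<in> \<D>"
  shows "1 + z\<^sup>2 \<notin> \<real>\<^sub>\<le>\<^sub>0"
proof -
  have "norm (z\<^sup>2) < 1"
    using assms by (simp add: norm_power power_less_one_iff)
  then have "Re (1 + z\<^sup>2) > 0"
    using abs_Re_le_cmod[of "z\<^sup>2"] by simp
  then show ?thesis
    by (auto simp: complex_nonpos_Reals_iff)
qed

lemma holomorphic_lune_q: "lune_q holomorphic_on \<D>"
  unfolding lune_q_def[abs_def] by (intro holomorphic_intros lune_radicand)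

text \<open>A quadratic equation for q that eliminates the square root and makes the coefficients of
  q(w(z)) computable by recursion.\<close>

lemma lune_q_square: "(lune_q z)\<^sup>2 = 2 * z * lune_q z + 1"
proof -
  have "(csqrt (1 + z\<^sup>2))\<^sup>2 = 1 + z\<^sup>2" by simp
  then show ?thesis
    unfolding lune_q_def by (simp add: power2_eq_square algebra_simps del: power2_csqrt)
qed

lemma lune_q_0 [simp]: "lune_q 0 = 1"
  by (simp add: lune_q_def)

text \<open>With s the principal root of 1 + u, (s - 1)(s + 1) = u, and Re s \<ge> 0 gives |s + 1|
  \<ge> 1.\<close>

lemma norm_csqrt_minus_1_le: "norm (csqrt (1 + u) - 1) \<le> norm u"
proof -
  have "0 \<le> Re (csqrt (1 + u))"
    using csqrt_principal[of "1 + u"] by auto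
  then have ge: "1 \<le> norm (csqrt (1 + u) + 1)"
    using complex_Re_le_cmod[of "csqrt (1 + u) + 1"] by (simp del: csqrt.sel)
  have "(csqrt (1 + u) - 1) * (csqrt (1 + u) + 1) = (csqrt (1 + u))\<^sup>2 - 1"
    by (simp add: algebra_simps power2_eq_square)
  also have "\<dots> = u" by simp
  finally have "norm u = norm (csqrt (1 + u) - 1) * norm (csqrt (1 + u) + 1)"
    by (metis norm_mult)
  then show ?thesis
    using mult_left_mono[OF ge, of "norm (csqrt (1 + u) - 1)"] by simp
qed

lemma norm_lune_q_minus_1_le: "norm (lune_q z - 1) \<le> norm z + (norm z)\<^sup>2"
proof -
  have "norm (lune_q z - 1) \<le> norm z + norm (csqrt (1 + z\<^sup>2) - 1)"
    unfolding lune_q_def using norm_triangle_ineq[of z "csqrt (1 + z\<^sup>2) - 1"] by (simp add: add_diff_eq)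
  also have "\<dots> \<le> norm z + (norm z)\<^sup>2"
    using norm_csqrt_minus_1_le[of "z\<^sup>2"] by (simp add: norm_power)
  finally show ?thesis .
qed

lemma holomorphic_lune_q_compose:
  assumes "w holomorphic_on \<D>" "w ` \<D> \<subseteq> \<D>"
  shows "(\<lambda>z. lune_q (w z) - 1) holomorphic_on \<D>"
  using holomorphic_on_compose_gen[OF assms(1) holomorphic_lune_q assms(2)]
  by (intro holomorphic_intros) (simp add: o_def)

text \<open>For P = q(w) - 1 the quadratic equation of q reads P^2 + 2P = 2wP + 2w. As P and w
  vanish at 0, each coefficient of P is determined by earlier ones and those of w. The fourth serves
  the z^5 coefficient of \<open>lune_h\<close>.\<close>

lemma lune_q_compose_coeffs:
  assumes w: "w holomorphic_on \<D>" "w ` \<D> \<subseteq> \<D>" "w 0 = 0"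
  defines "c \<equiv> fps_nth (fps_expansion w 0)"
    and "p \<equiv> fps_nth (fps_expansion (\<lambda>z. lune_q (w z) - 1) 0)"
  shows "p 0 = 0" "p 1 = c 1" "p 2 = c 2 + (c 1)\<^sup>2 / 2" "p 3 = c 3 + c 1 * c 2"
    "p 4 = c 4 + c 1 * c 3 + (c 2)\<^sup>2 / 2 - c 1 ^ 4 / 8"
proof -
  let ?P = "fps_expansion (\<lambda>z. lune_q (w z) - 1) 0" and ?W = "fps_expansion w 0"
  have P: "(\<lambda>z. lune_q (w z) - 1) has_fps_expansion ?P"
    by (rule holomorphic_has_fps_expansion[OF holomorphic_lune_q_compose[OF w(1,2)]])
  have "?P * ?P + 2 * ?P = 2 * ?W * ?P + 2 * ?W"
  proof (rule has_fps_expansion_eq_on_disc)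
    show "(\<lambda>z. (lune_q (w z) - 1) * (lune_q (w z) - 1) + 2 * (lune_q (w z) - 1))
        has_fps_expansion ?P * ?P + 2 * ?P"
      by (intro fps_expansion_intros P)
    show "(\<lambda>z. 2 * w z * (lune_q (w z) - 1) + 2 * w z) has_fps_expansion 2 * ?W * ?P + 2 * ?W"
      by (intro fps_expansion_intros P holomorphic_has_fps_expansion w(1))
    show "(lune_q (w z) - 1) * (lune_q (w z) - 1) + 2 * (lune_q (w z) - 1) =
        2 * w z * (lune_q (w z) - 1) + 2 * w z" for z
      using lune_q_square[of "w z"] by (simp add: algebra_simps power2_eq_square)
  qed
  then have "(?P * ?P + 2 * ?P) $ n = (2 * (?W * ?P + ?W)) $ n" for n
    by (simp add: algebra_simps)
  then have *: "(?P * ?P) $ n + 2 * p n = 2 * ((?W * ?P) $ n + c n)" for n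
    by (simp add: p_def c_def fps_numeral_fps_const)
  show "p 0 = 0"
    by (simp add: w p_def)
  show p1: "p 1 = c 1"
    using *[of 1] by (simp add: fps_mult_nth w)
  have "p 1 * p 1 + 2 * p 2 = 2 * (c 1 * p 1 + c 2)"
    using *[of 2] by (simp add: fps_mult_nth w p_def c_def numeral_2_eq_2)
  then show p2: "p 2 = c 2 + (c 1)\<^sup>2 / 2"
    unfolding p1 by (simp add: field_simps power2_eq_square)
  have "2 * p 3 = 2 * (c 1 * p 2 + c 2 * p 1 + c 3) - 2 * p 1 * p 2"
    using *[of 3] by (simp add: fps_mult_nth w p_def c_def numeral_2_eq_2 numeral_3_eq_3 algebra_simps)
  also have "\<dots> = 2 * (c 3 + c 1 * c 2)"
    unfolding p1 p2 by (simp add: field_simps power2_eq_square)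
  finally show p3: "p 3 = c 3 + c 1 * c 2"
    by (simp only: mult_cancel_left) simp
  have "2 * p 4 = 2 * (c 1 * p 3 + c 2 * p 2 + c 3 * p 1 + c 4) - (2 * p 1 * p 3 + p 2 * p 2)"
    using *[of 4] by (simp add: fps_mult_nth w p_def c_def eval_nat_numeral algebra_simps)
  also have "\<dots> = 2 * (c 4 + c 1 * c 3 + (c 2)\<^sup>2 / 2 - c 1 ^ 4 / 8)"
    unfolding p1 p2 p3 by (simp add: field_simps power2_eq_square power4_eq_xxxx)
  finally show "p 4 = c 4 + c 1 * c 3 + (c 2)\<^sup>2 / 2 - c 1 ^ 4 / 8"
    by (simp only: mult_cancel_left) simp
qed

section \<open>From the pre-Schwarzian equation to the functional of the Schwarz function\<close>

lemma pre_Schwarzian_coeffs: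
  assumes f: "f holomorphic_on \<D>" "deriv f 0 = 1"
    and p: "p holomorphic_on \<D>" "p 0 = 0"
    and ode: "\<And>z. z \<in> \<D> \<Longrightarrow> z * deriv (deriv f) z = p z * deriv f z"
  defines "a \<equiv> fps_nth (fps_expansion f 0)" and "b \<equiv> fps_nth (fps_expansion p 0)"
  shows "2 * a 2 = b 1" "6 * a 3 = b 2 + 2 * a 2 * b 1"
    "12 * a 4 = b 3 + 2 * a 2 * b 2 + 3 * a 3 * b 1"
    "20 * a 5 = b 4 + 2 * a 2 * b 3 + 3 * a 3 * b 2 + 4 * a 4 * b 1"
proof -
  let ?A = "fps_expansion f 0" and ?B = "fps_expansion p 0"
  \<comment> \<open>The coefficient of z^n on the left is n (n + 1) a(n+1). Because p(0) = 0, the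
    right side contains only a(1), ..., a(n), so the equation is a recursion.\<close>
  have "fps_X * fps_deriv (fps_deriv ?A) = ?B * fps_deriv ?A"
    unfolding fps_expansion_deriv[symmetric]
    by (rule has_fps_expansion_eq_on_disc[OF
          has_fps_expansion_mult[OF has_fps_expansion_fps_X holomorphic_has_fps_expansion]
          has_fps_expansion_mult[OF holomorphic_has_fps_expansion holomorphic_has_fps_expansion]])
       (use f p ode in \<open>auto intro!: deriv_holomorphic_on_disc\<close>)
  then have *: "(fps_X * fps_deriv (fps_deriv ?A)) $ n = (?B * fps_deriv ?A) $ n" for n
    by simp
  show "2 * a 2 = b 1"
    using *[of 1] by (simp add: f p a_def b_def numeral_2_eq_2)
  show "6 * a 3 = b 2 + 2 * a 2 * b 1"
    using *[of 2] by (simp add: f p fps_mult_nth a_def b_def eval_nat_numeral algebra_simps)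
  show "12 * a 4 = b 3 + 2 * a 2 * b 2 + 3 * a 3 * b 1"
    using *[of 3] by (simp add: f p fps_mult_nth a_def b_def eval_nat_numeral algebra_simps)
  show "20 * a 5 = b 4 + 2 * a 2 * b 3 + 3 * a 3 * b 2 + 4 * a 4 * b 1"
    using *[of 4] by (simp add: f p fps_mult_nth a_def b_def eval_nat_numeral algebra_simps)
qed

text \<open>Reduces the determinant to the first three coefficients of w. Keeping w explicit serves
  both the upper bound, for arbitrary w, and the evaluation at the extremal w.\<close>

lemma H21_log_pre_Schwarzian:
  assumes f: "f \<in> class_S" and w: "w holomorphic_on \<D>" "w ` \<D> \<subseteq> \<D>" "w 0 = 0"
    and ode: "\<And>z. z \<in> \<D> \<Longrightarrow> z * deriv (deriv f) z = (lune_q (w z) - 1) * deriv f z"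
  defines "c \<equiv> fps_nth (fps_expansion w 0)"
  shows "48 * H21_log f = - (c 1 ^ 4 / 16) + (c 1)\<^sup>2 * c 2 / 4 - (c 2)\<^sup>2 / 3 + c 1 * c 3 / 2"
proof -
  have f': "f holomorphic_on \<D>" "deriv f 0 = 1"
    using f by (auto simp: class_S_def)
  define a where "a = fps_nth (fps_expansion f 0)"
  note p = lune_q_compose_coeffs[OF w, folded c_def]
  note a = pre_Schwarzian_coeffs[OF f' holomorphic_lune_q_compose[OF w(1,2)] _ ode,
      unfolded p w(3), folded a_def, simplified]
  have a2: "a 2 = c 1 / 2"
    using a(1) by (simp add: field_simps)
  have a3: "a 3 = (c 2 + 3 / 2 * (c 1)\<^sup>2) / 6"
    using a(2) unfolding a2 by (simp add: field_simps power2_eq_square)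
  have "12 * a 4 = c 3 + 5 / 2 * c 1 * c 2 + 5 / 4 * c 1 ^ 3"
    unfolding a(3) a2 a3 by (simp add: field_simps power2_eq_square power3_eq_cube)
  then have a4: "a 4 = (c 3 + 5 / 2 * c 1 * c 2 + 5 / 4 * c 1 ^ 3) / 12"
    by (simp add: eq_divide_eq mult.commute)
  have "48 * H21_log f = a 2 ^ 4 - 12 * a 3 ^ 2 + 12 * a 2 * a 4"
    using H21_log_eq[OF f] by (simp add: a_def)
  also have "\<dots> = - (c 1 ^ 4 / 16) + (c 1)\<^sup>2 * c 2 / 4 - (c 2)\<^sup>2 / 3 + c 1 * c 3 / 2"
    unfolding a2 a3 a4 by (simp add: field_simps power2_eq_square power3_eq_cube power4_eq_xxxx)
  finally show ?thesis .
qed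

text \<open>Univalence makes f' zero-free, so subordination can be written without a
  quotient.\<close>

lemma C_lune_ode:
  assumes "f \<in> C_lune"
  obtains w where "w holomorphic_on \<D>" "w ` \<D> \<subseteq> \<D>" "w 0 = 0"
    "\<And>z. z \<in> \<D> \<Longrightarrow> z * deriv (deriv f) z = (lune_q (w z) - 1) * deriv f z"
proof -
  have f: "f holomorphic_on \<D>" "inj_on f \<D>"
    using assms by (auto simp: C_lune_def class_S_def)
  obtain w where w: "w holomorphic_on \<D>" "w ` \<D> \<subseteq> \<D>" "w 0 = 0"
    "\<And>z. z \<in> \<D> \<Longrightarrow> 1 + z * deriv (deriv f) z / deriv f z = lune_q (w z)"
    using assms unfolding C_lune_def subordinate_def by blast
  have "z * deriv (deriv f) z = (lune_q (w z) - 1) * deriv f z" if "z \<in> \<D>" for z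
    using w(4)[OF that] holomorphic_injective_imp_regular[OF f(1) open_ball f(2) that]
    by (simp add: w(4)[OF that, symmetric])
  then show ?thesis
    using that w(1-3) by blast
qed

lemma C_lune_I:
  assumes f: "f \<in> class_S" and w: "w holomorphic_on \<D>" "w ` \<D> \<subseteq> \<D>" "w 0 = 0"
    and ode: "\<And>z. z \<in> \<D> \<Longrightarrow> z * deriv (deriv f) z = (lune_q (w z) - 1) * deriv f z"
  shows "f \<in> C_lune"
proof -
  have f': "f holomorphic_on \<D>" "inj_on f \<D>"
    using f by (auto simp: class_S_def)
  have "1 + z * deriv (deriv f) z / deriv f z = lune_q (w z)" if "z \<in> \<D>" for z
    using holomorphic_injective_imp_regular[OF f'(1) open_ball f'(2) that] ode[OF that] by simp
  then show ?thesis
    using f w unfolding C_lune_def subordinate_def by blast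
qed

subsection \<open>Univalence and existence\<close>

lemma holomorphic_primitive_on_disc:
  assumes "f holomorphic_on \<D>"
  obtains F where "F holomorphic_on \<D>" "F 0 = 0"
    "\<And>z. z \<in> \<D> \<Longrightarrow> (F has_field_derivative f z) (at z)"
proof -
  obtain G where G: "\<And>z. z \<in> \<D> \<Longrightarrow> (G has_field_derivative f z) (at z within \<D>)"
    using holomorphic_convex_primitive'[OF convex_ball open_ball assms] by blast
  have F: "((\<lambda>z. G z - G 0) has_field_derivative f z) (at z)" if "z \<in> \<D>" for z
    using DERIV_diff[OF G[OF that] DERIV_const[of "G 0"]] that
    by (simp add: at_within_open[of z \<D>])
  then have "(\<lambda>z. G z - G 0) holomorphic_on \<D>"
    unfolding holomorphic_on_open[OF open_ball] by blast
  then show ?thesis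
    using that[of "\<lambda>z. G z - G 0"] F by simp
qed

lemma Noshiro_Warschawski:
  assumes f: "\<And>z. z \<in> \<D> \<Longrightarrow> (f has_field_derivative f' z) (at z)"
    and pos: "\<And>z. z \<in> \<D> \<Longrightarrow> Re (f' z) > 0"
  shows "inj_on f \<D>"
proof (rule inj_onI, rule ccontr)
  fix w z assume wz: "w \<in> \<D>" "z \<in> \<D>" "f w = f z" "w \<noteq> z"
  have seg: "u \<in> \<D>" if "u \<in> closed_segment w z" for u
    using that wz closed_segment_subset[OF wz(1,2) convex_ball] by blast
  \<comment> \<open>Dividing f by z - w makes the derivative along the segment from w to z equal to
    f' itself, so the mean value theorem for the real part yields Re f'(u) = 0 when f(w) =
    f(z).\<close>
  obtain u where u: "u \<in> closed_segment w z"
    "Re (f z / (z - w)) - Re (f w / (z - w)) = Re (f' u / (z - w) * (z - w))"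
    using complex_mvt_line[of w z "\<lambda>x. f x / (z - w)" "\<lambda>x. f' x / (z - w)"]
      DERIV_cdivide[OF f[OF seg]] by blast
  then have "Re (f' u) = 0"
    using wz by simp
  then show False
    using pos[OF seg[OF u(1)]] by simp
qed

text \<open>Integration of the derivative bound along the radius x z with 0 \<le> x \<le> 1, carried
  out by comparison with the real function A |z| x + B |z|^2 x^2 / 2.\<close>

lemma norm_primitive_le:
  assumes g: "g holomorphic_on \<D>" "g 0 = 0"
    and bound: "\<And>z. z \<in> \<D> \<Longrightarrow> norm (z * deriv g z) \<le> A * norm z + B * (norm z)\<^sup>2"
    and z: "z \<in> \<D>"
  shows "norm (g z) \<le> A * norm z + B / 2 * (norm z)\<^sup>2"
proof -
  have in_disc: "of_real x * z \<in> \<D>" if "0 \<le> x" "x \<le> 1" for x :: real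
    using z that mult_left_le_one_le[of "norm z" x] by (simp add: norm_mult)
  have der: "((\<lambda>x. g (of_real x * z)) has_vector_derivative z * deriv g (of_real x * z)) (at x)"
    if "0 \<le> x" "x \<le> 1" for x :: real
  proof -
    have "((\<lambda>x. of_real x * z) has_vector_derivative z) (at x)"
      by (auto intro!: derivative_eq_intros)
    from field_vector_diff_chain_at[OF this holomorphic_derivI[OF g(1) open_ball in_disc[OF that]]]
    show ?thesis
      by (simp add: o_def)
  qed
  have "norm (g (of_real 1 * z) - g (of_real 0 * z)) \<le>
      (A * norm z * 1 + B * (norm z)\<^sup>2 * 1\<^sup>2 / 2) - (A * norm z * 0 + B * (norm z)\<^sup>2 * 0\<^sup>2 / 2)"
  proof (rule differentiable_bound_general[where a = 0 and b = 1
        and f = "\<lambda>x. g (of_real x * z)" and f' = "\<lambda>x. z * deriv g (of_real x * z)"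
        and \<phi> = "\<lambda>x. A * norm z * x + B * (norm z)\<^sup>2 * x\<^sup>2 / 2"
        and \<phi>' = "\<lambda>x. A * norm z + B * (norm z)\<^sup>2 * x"])
    show "continuous_on {0..1} (\<lambda>x. g (of_real x * z))"
      by (intro continuous_at_imp_continuous_on ballI has_vector_derivative_continuous[OF der]) auto
    show "continuous_on {0..1} (\<lambda>x. A * norm z * x + B * (norm z)\<^sup>2 * x\<^sup>2 / 2)"
      by (intro continuous_intros) auto
    fix x :: real assume x: "0 < x" "x < 1"
    then show "((\<lambda>x. g (of_real x * z)) has_vector_derivative z * deriv g (of_real x * z)) (at x)"
      by (intro der) auto
    show "((\<lambda>x. A * norm z * x + B * (norm z)\<^sup>2 * x\<^sup>2 / 2) has_vector_derivative
        A * norm z + B * (norm z)\<^sup>2 * x) (at x)"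
      unfolding has_real_derivative_iff_has_vector_derivative[symmetric]
      by (auto intro!: derivative_eq_intros)
    \<comment> \<open>The hypothesis bounds the derivative multiplied by x z; the factor x is
      cancelled, which is possible in the open interval.\<close>
    have "x * norm (z * deriv g (of_real x * z)) = norm (of_real x * z * deriv g (of_real x * z))"
      using x by (simp add: norm_mult)
    also have "\<dots> \<le> A * norm (of_real x * z) + B * (norm (of_real x * z))\<^sup>2"
      by (rule bound) (use in_disc x in auto)
    also have "\<dots> = x * (A * norm z + B * (norm z)\<^sup>2 * x)"
      using x by (simp add: norm_mult power2_eq_square algebra_simps)
    finally show "norm (z * deriv g (of_real x * z)) \<le> A * norm z + B * (norm z)\<^sup>2 * x"
      using x by simp
  qed simp
  then show ?thesis
    by (simp add: g(2))
qed

text \<open>The constant 3/2 lies below pi/2 and is reached exactly in both applications: A = B = 1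
  for members of the class and A = 0, B = 3 for \<open>lune_h\<close>.\<close>

lemma class_S_primitive_exp:
  assumes f: "f 0 = 0" "\<And>z. z \<in> \<D> \<Longrightarrow> (f has_field_derivative exp (g z)) (at z)"
    and g: "g holomorphic_on \<D>" "g 0 = 0"
    and bound: "\<And>z. z \<in> \<D> \<Longrightarrow> norm (z * deriv g z) \<le> A * norm z + B * (norm z)\<^sup>2"
    and AB: "0 \<le> A" "0 \<le> B" "A + B / 2 \<le> 3 / 2"
  shows "f \<in> class_S" "\<And>z. z \<in> \<D> \<Longrightarrow> z * deriv (deriv f) z = z * deriv g z * deriv f z"
proof -
  have df: "deriv f z = exp (g z)" if "z \<in> \<D>" for z
    using f(2)[OF that] by (rule DERIV_imp_deriv)
  have pos: "Re (exp (g z)) > 0" if "z \<in> \<D>" for z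
  proof -
    have "\<bar>Im (g z)\<bar> \<le> norm (g z)"
      by (rule abs_Im_le_cmod)
    also have "\<dots> \<le> A * norm z + B / 2 * (norm z)\<^sup>2"
      by (rule norm_primitive_le[OF g bound that])
    also have "\<dots> \<le> A * 1 + B / 2 * 1"
      using that AB by (intro add_mono mult_left_mono) (auto simp: power_le_one)
    also have "\<dots> < pi / 2"
      using AB pi_approx by simp
    finally have "cos (Im (g z)) > 0"
      by (intro cos_gt_zero_pi) auto
    then show ?thesis
      by (simp add: Re_exp)
  qed
  have "inj_on f \<D>"
    by (rule Noshiro_Warschawski[OF f(2) pos])
  moreover have "f holomorphic_on \<D>"
    unfolding holomorphic_on_open[OF open_ball] using f(2) by blast
  ultimately show "f \<in> class_S"
    using f(1) df[of 0] g(2) by (simp add: class_S_def)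
  fix z :: complex assume z: "z \<in> \<D>"
  have "((\<lambda>z. exp (g z)) has_field_derivative exp (g z) * deriv g z) (at z)"
    by (rule DERIV_chain2[OF DERIV_exp holomorphic_derivI[OF g(1) open_ball z]])
  then have "(deriv f has_field_derivative exp (g z) * deriv g z) (at z)"
    by (rule has_field_derivative_transform_within_open[where S = \<D>]) (use z df in auto)
  then have "deriv (deriv f) z = exp (g z) * deriv g z"
    by (rule DERIV_imp_deriv)
  then show "z * deriv (deriv f) z = z * deriv g z * deriv f z"
    using df[OF z] by simp
qed

text \<open>Solve the equation by two primitives: g' = (q(w) - 1)/z and then f' = exp g. The
  equation is returned along with f because membership alone does not record which w was
  used.\<close>

lemma C_lune_exists:
  assumes w: "w holomorphic_on \<D>" "w ` \<D> \<subseteq> \<D>" "w 0 = 0"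
  obtains f where "f \<in> C_lune"
    "\<And>z. z \<in> \<D> \<Longrightarrow> z * deriv (deriv f) z = (lune_q (w z) - 1) * deriv f z"
proof -
  have w_lt: "norm (w z) < 1" if "norm z < 1" for z
    using w(2) that by (auto simp: image_subset_iff)
  obtain r where r: "r holomorphic_on \<D>" "\<And>z. norm z < 1 \<Longrightarrow> lune_q (w z) - 1 = z * r z"
    using Schwarz3[OF holomorphic_lune_q_compose[OF w(1,2)]] w(3) by auto
  obtain g where g: "g holomorphic_on \<D>" "g 0 = 0"
    "\<And>z. z \<in> \<D> \<Longrightarrow> (g has_field_derivative r z) (at z)"
    using holomorphic_primitive_on_disc[OF r(1)] by blast
  have dg: "z * deriv g z = lune_q (w z) - 1" if "z \<in> \<D>" for z
    using DERIV_imp_deriv[OF g(3)[OF that]] r(2)[of z] that by simp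
  obtain f where f: "f 0 = 0" "\<And>z. z \<in> \<D> \<Longrightarrow> (f has_field_derivative exp (g z)) (at z)"
    using holomorphic_primitive_on_disc[OF holomorphic_on_exp'[OF g(1)]] by blast
  have bound: "norm (z * deriv g z) \<le> 1 * norm z + 1 * (norm z)\<^sup>2" if "z \<in> \<D>" for z
  proof -
    \<comment> \<open>Schwarz's lemma turns the bound for q in |w(z)| into one in |z|.\<close>
    have "norm (w z) \<le> norm z"
      using Schwarz_Lemma(1)[OF w(1,3) w_lt, of z] that by simp
    then have "norm (w z) + (norm (w z))\<^sup>2 \<le> norm z + (norm z)\<^sup>2"
      by (intro add_mono power_mono) auto
    then show ?thesis
      unfolding dg[OF that] using norm_lune_q_minus_1_le[of "w z"] by simp
  qed
  note class_S_primitive_exp[OF f g(1,2) bound]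
  then have "f \<in> class_S" and
    ode: "\<And>z. z \<in> \<D> \<Longrightarrow> z * deriv (deriv f) z = (lune_q (w z) - 1) * deriv f z"
    using dg by simp_all
  then show ?thesis
    using that C_lune_I[OF _ w ode] by blast
qed

text \<open>Evaluates the integrals defining \<open>lune_h0\<close> and \<open>lune_h\<close>, whose
  integrands have a removable singularity at 0 and may take a wrong value there. For z distinct from
  0 the path meets 0 only at parameter 0, and one point does not affect the integral.\<close>

lemma contour_integral_linepath_0:
  assumes F: "\<And>z. z \<in> \<D> \<Longrightarrow> (F has_field_derivative f z) (at z)" "F 0 = 0"
    and u: "\<And>z. z \<in> \<D> - {0} \<Longrightarrow> u z = f z" and z: "z \<in> \<D>"
  shows "contour_integral (linepath 0 z) u = F z"
proof (cases "z = 0")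
  case False
  have sub: "path_image (linepath 0 z) \<subseteq> \<D>"
    using z closed_segment_subset[of 0 \<D> z] by simp
  have "(f has_contour_integral F z) (linepath 0 z)"
    using contour_integral_primitive[OF DERIV_subset[OF F(1)] valid_path_linepath sub] F(2) by simp
  then have "(u has_contour_integral F z) (linepath 0 z)"
    unfolding has_contour_integral_linepath
  proof (rule has_integral_spike_finite[rotated 2])
    fix x :: real assume "x \<in> {0..1} - {0}"
    then have "linepath 0 z x \<in> path_image (linepath 0 z)" "linepath 0 z x \<noteq> 0"
      using False by (auto simp: path_image_def linepath_def)
    then show "u (linepath 0 z x) * (z - 0) = f (linepath 0 z x) * (z - 0)"
      using u sub by auto
  qed simp
  then show ?thesis
    by (rule contour_integral_unique)
qed (use F in simp)

subsection \<open>The extremal functions\<close>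

lemma norm_H21_log_C_lune_le:
  assumes "f \<in> C_lune"
  shows "norm (H21_log f) \<le> 23 / 3264"
proof -
  have f: "f \<in> class_S"
    using assms by (simp add: C_lune_def)
  obtain w where w: "w holomorphic_on \<D>" "w ` \<D> \<subseteq> \<D>" "w 0 = 0"
    and ode: "\<And>z. z \<in> \<D> \<Longrightarrow> z * deriv (deriv f) z = (lune_q (w z) - 1) * deriv f z"
    using C_lune_ode[OF assms] by blast
  have "norm (48 * H21_log f) \<le> 23 / 68"
    using Schwarz_functional_le[OF w] H21_log_pre_Schwarzian[OF f w ode] by simp
  then show ?thesis
    by (simp add: norm_mult)
qed

text \<open>The extremal member of the class is built from its own Schwarz function;
  \<open>lune_h\<close> gives the same value but is shown only to lie in
  \<open>class_S\<close>.\<close>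

lemma norm_H21_log_C_lune_attained:
  "\<exists>f\<in>C_lune. norm (H21_log f) = 23 / 3264"
proof -
  define c :: complex where "c = of_real (sqrt (2 / 17))"
  have c_sq: "c * c = 2 / 17"
    unfolding c_def of_real_mult[symmetric] by simp
  have c_lt: "norm c < 1"
    by (simp add: c_def)
  \<comment> \<open>This is z (c - z) / (1 - c z), the case x = -1, y = 0 of the Schur
    parametrization. With c^2 = 2/17, all four terms of the functional are negative and the
    quadratic majorant is at its maximum.\<close>
  define w where "w z = - (z * Moebius_function 0 c z)" for z
  have w: "w holomorphic_on \<D>" "w ` \<D> \<subseteq> \<D>" "w 0 = 0"
  proof -
    show "w holomorphic_on \<D>"
      unfolding w_def[abs_def] by (intro holomorphic_intros Moebius_function_holomorphic c_lt)
    show "w ` \<D> \<subseteq> \<D>"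
    proof
      fix u assume "u \<in> w ` \<D>"
      then obtain z where z: "norm z < 1" "u = w z"
        by auto
      have "norm z * norm (Moebius_function 0 c z) < 1 * 1"
        by (intro mult_strict_mono' z Moebius_function_norm_lt_1 c_lt norm_ge_zero)
      then show "u \<in> \<D>"
        by (simp add: z w_def norm_mult)
    qed
  qed (simp add: w_def)
  have w_eq: "w z * (1 - c * z) = c * z - z\<^sup>2" if "z \<in> \<D>" for z
  proof -
    have "norm (c * z) < 1 * 1"
      unfolding norm_mult using that by (intro mult_strict_mono' c_lt norm_ge_zero) simp
    then have "1 - c * z \<noteq> 0"
      by auto
    then show ?thesis
      by (simp add: w_def Moebius_function_simple c_def field_simps power2_eq_square)
  qed
  let ?W = "fps_expansion w 0"
  have "?W * (1 - fps_const c * fps_X) = fps_const c * fps_X - fps_X\<^sup>2"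
  proof (rule has_fps_expansion_eq_on_disc[OF _ _ w_eq])
    show "(\<lambda>z. w z * (1 - c * z)) has_fps_expansion ?W * (1 - fps_const c * fps_X)"
      by (intro fps_expansion_intros holomorphic_has_fps_expansion w(1))
    show "(\<lambda>z. c * z - z\<^sup>2) has_fps_expansion fps_const c * fps_X - fps_X\<^sup>2"
      by (intro fps_expansion_intros)
  qed
  then have *: "(?W * (1 - fps_const c * fps_X)) $ n = (fps_const c * fps_X - fps_X\<^sup>2) $ n" for n
    by simp
  have W0: "?W $ 0 = 0"
    by (simp add: w(3))
  have W1: "?W $ 1 = c"
    using *[of 1] by (simp add: w(3) fps_X_power_nth)
  have W2: "?W $ 2 = c * c - 1"
    using *[of 2] W1 by (simp add: fps_mult_nth w(3) numeral_2_eq_2 fps_X_power_nth fps_X_nth algebra_simps)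
  have "?W $ 3 = c * ?W $ 2"
    using *[of 3] by (simp add: fps_mult_nth w(3) numeral_2_eq_2 numeral_3_eq_3 fps_X_power_nth
        fps_X_nth algebra_simps)
  then have W3: "?W $ 3 = c * (c * c - 1)"
    unfolding W2 .
  obtain f where f: "f \<in> C_lune"
    and ode: "\<And>z. z \<in> \<D> \<Longrightarrow> z * deriv (deriv f) z = (lune_q (w z) - 1) * deriv f z"
    using C_lune_exists[OF w] by blast
  have "f \<in> class_S"
    using f by (simp add: C_lune_def)
  then have "48 * H21_log f =
      - (c ^ 4 / 16) + c\<^sup>2 * (c * c - 1) / 4 - (c * c - 1)\<^sup>2 / 3 + c * (c * (c * c - 1)) / 2"
    using H21_log_pre_Schwarzian[OF _ w ode] unfolding W1 W2 W3 by simp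
  also have "\<dots> = - ((c * c)\<^sup>2 / 16) + (c * c) * (c * c - 1) / 4 - (c * c - 1)\<^sup>2 / 3
      + (c * c) * (c * c - 1) / 2"
    by (simp add: power2_eq_square power4_eq_xxxx algebra_simps)
  also have "\<dots> = - (23 / 68)"
    unfolding c_sq by (simp add: power2_eq_square)
  finally have "norm (48 * H21_log f) = 23 / 68"
    by (simp add: norm_divide)
  then have "norm (H21_log f) = 23 / 3264"
    by (simp add: norm_mult)
  with f show ?thesis
    by blast
qed

text \<open>The factor k > 1 stands outside q(z^2) - 1, so the equation is not of the form q(w) - 1
  with w(z) = z^2; univalence still follows from the exponential criterion.\<close>

lemma lune_h_properties:
  defines "k \<equiv> complex_of_real (sqrt (69 / 68))"
  shows lune_h_class_S: "lune_h \<in> class_S"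
    and lune_h_ode: "\<And>z. z \<in> \<D> \<Longrightarrow>
      z * deriv (deriv lune_h) z = (k * (lune_q (z\<^sup>2) - 1)) * deriv lune_h z"
proof -
  have sq: "(\<lambda>z::complex. z\<^sup>2) holomorphic_on \<D>" "(\<lambda>z::complex. z\<^sup>2) ` \<D> \<subseteq> \<D>"
    by (intro holomorphic_intros) (auto simp: norm_power power_less_one_iff)
  obtain r where r: "r holomorphic_on \<D>" "\<And>z. norm z < 1 \<Longrightarrow> lune_q (z\<^sup>2) - 1 = z * r z"
    using Schwarz3[OF holomorphic_lune_q_compose[OF sq]] by auto
  obtain g where g: "g holomorphic_on \<D>" "g 0 = 0"
    "\<And>z. z \<in> \<D> \<Longrightarrow> (g has_field_derivative r z) (at z)"
    using holomorphic_primitive_on_disc[OF r(1)] by blast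
  \<comment> \<open>The integrand is (q(x^2) - 1)/x, since q(x^2) = x^2 + sqrt(1 + x^4).\<close>
  have "contour_integral (linepath 0 z) (\<lambda>x. (x ^ 2 + csqrt (1 + x ^ 4) - 1) / x) = g z"
    if "z \<in> \<D>" for z
  proof (rule contour_integral_linepath_0[OF g(3,2) _ that])
    fix x :: complex assume "x \<in> \<D> - {0}"
    then show "(x ^ 2 + csqrt (1 + x ^ 4) - 1) / x = r x"
      using r(2)[of x] by (simp add: lune_q_def field_simps)
  qed
  then have h0: "lune_h0 z = z * exp (k * g z)" if "z \<in> \<D>" for z
    using that by (simp add: lune_h0_def k_def)
  have kg: "(\<lambda>z. k * g z) holomorphic_on \<D>"
    by (intro holomorphic_intros g(1))
  obtain F where F: "F 0 = 0" "\<And>z. z \<in> \<D> \<Longrightarrow> (F has_field_derivative exp (k * g z)) (at z)"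
    using holomorphic_primitive_on_disc[OF holomorphic_on_exp'[OF kg]] by blast
  have h_eq: "lune_h z = F z" if "z \<in> \<D>" for z
    unfolding lune_h_def
    by (rule contour_integral_linepath_0[OF F(2,1) _ that]) (use h0 in auto)
  have h: "(lune_h has_field_derivative exp (k * g z)) (at z)" if "z \<in> \<D>" for z
    using F(2)[OF that]
    by (rule has_field_derivative_transform_within_open[where S = \<D>]) (use that h_eq in auto)
  have dkg: "z * deriv (\<lambda>z. k * g z) z = k * (lune_q (z\<^sup>2) - 1)" if "z \<in> \<D>" for z
    using DERIV_imp_deriv[OF DERIV_cmult[OF g(3)[OF that], of k]] r(2)[of z] that by simp
  have "sqrt (69 / 68) \<le> (3 / 2 :: real)"
    by (rule real_le_lsqrt) (simp_all add: power2_eq_square)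
  then have k: "norm k \<le> 3 / 2"
    by (simp add: k_def)
  \<comment> \<open>Here |q(z^2) - 1| \<le> |z|^2 + |z|^4 \<le> 2 |z|^2, and the crude bound |k|
    \<le> 3/2 makes B = 3.\<close>
  have bound: "norm (z * deriv (\<lambda>z. k * g z) z) \<le> 0 * norm z + 3 * (norm z)\<^sup>2" if "z \<in> \<D>" for z
  proof -
    have "norm (lune_q (z\<^sup>2) - 1) \<le> (norm z)\<^sup>2 + (norm z)\<^sup>2 * (norm z)\<^sup>2"
      using norm_lune_q_minus_1_le[of "z\<^sup>2"] unfolding norm_power
      by (simp add: power2_eq_square)
    also have "\<dots> \<le> (norm z)\<^sup>2 + (norm z)\<^sup>2 * 1"
      using that by (intro add_left_mono mult_left_mono) (auto simp: power_le_one)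
    finally have "norm k * norm (lune_q (z\<^sup>2) - 1) \<le> 3 / 2 * (2 * (norm z)\<^sup>2)"
      using k by (intro mult_mono) auto
    then show ?thesis
      unfolding dkg[OF that] by (simp add: norm_mult)
  qed
  have "lune_h 0 = 0"
    using h_eq[of 0] F(1) by simp
  note class_S_primitive_exp[OF this h kg _ bound]
  then show "lune_h \<in> class_S"
    and "\<And>z. z \<in> \<D> \<Longrightarrow> z * deriv (deriv lune_h) z = (k * (lune_q (z\<^sup>2) - 1)) * deriv lune_h z"
    using dkg g(2) by simp_all
qed

lemma lune_h_coeffs:
  defines "a \<equiv> fps_nth (fps_expansion lune_h 0)" and "k \<equiv> complex_of_real (sqrt (69 / 68))"
  shows "a 2 = 0" "a 3 = k / 6" "a 4 = 0" "a 5 = (k + k\<^sup>2) / 40"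
proof -
  have sq: "(\<lambda>z::complex. z\<^sup>2) holomorphic_on \<D>" "(\<lambda>z::complex. z\<^sup>2) ` \<D> \<subseteq> \<D>" "(0::complex)\<^sup>2 = 0"
    by (intro holomorphic_intros) (auto simp: norm_power power_less_one_iff)
  let ?p = "\<lambda>z. lune_q (z\<^sup>2) - 1"
  define b where "b = fps_nth (fps_expansion ?p 0)"
  have p_hol: "?p holomorphic_on \<D>"
    by (rule holomorphic_lune_q_compose[OF sq(1,2)])
  have X2: "fps_expansion (\<lambda>z::complex. z\<^sup>2) 0 = fps_X\<^sup>2"
    by (intro fps_expansion_eqI fps_expansion_intros)
  \<comment> \<open>The coefficients of q(z^2) - 1, from the general formulas with w(z) = z^2, where
    only c2 = 1 is nonzero.\<close>
  have b: "b 1 = 0" "b 2 = 1" "b 3 = 0" "b 4 = 1 / 2"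
    using lune_q_compose_coeffs[OF sq] unfolding X2 b_def by (simp_all add: fps_X_power_nth)
  have kp: "fps_expansion (\<lambda>z. k * ?p z) 0 = fps_const k * fps_expansion ?p 0"
    by (intro fps_expansion_eqI fps_expansion_intros holomorphic_has_fps_expansion p_hol)
  have h: "lune_h holomorphic_on \<D>" "deriv lune_h 0 = 1"
    using lune_h_class_S by (auto simp: class_S_def)
  have kp_hol: "(\<lambda>z. k * ?p z) holomorphic_on \<D>"
    by (intro holomorphic_intros p_hol)
  have "2 * a 2 = k * b 1" "6 * a 3 = k * b 2 + 2 * a 2 * (k * b 1)"
    "12 * a 4 = k * b 3 + 2 * a 2 * (k * b 2) + 3 * a 3 * (k * b 1)"
    "20 * a 5 = k * b 4 + 2 * a 2 * (k * b 3) + 3 * a 3 * (k * b 2) + 4 * a 4 * (k * b 1)"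
    using pre_Schwarzian_coeffs[OF h kp_hol _ lune_h_ode[folded k_def]]
    unfolding kp a_def b_def by simp_all
  note a = this[unfolded b]
  show a2: "a 2 = 0"
    using a(1) by simp
  show a3: "a 3 = k / 6"
    using a(2) unfolding a2 by (simp add: field_simps)
  show "a 4 = 0"
    using a(3) unfolding a2 by simp
  show "a 5 = (k + k\<^sup>2) / 40"
    using a(4) unfolding a2 a3 by (simp add: field_simps power2_eq_square)
qed

theorem theorem4p1:
  shows "(\<forall>f\<in>C_lune. norm (H21_log f) \<le> 23 / 3264)
    \<and> (\<exists>f\<in>C_lune. norm (H21_log f) = 23 / 3264)
    \<and> lune_h \<in> class_S
    \<and> fps_nth (fps_expansion lune_h 0) 2 = 0
    \<and> fps_nth (fps_expansion lune_h 0) 3 = complex_of_real (sqrt 69 / (12 * sqrt 17))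
    \<and> fps_nth (fps_expansion lune_h 0) 4 = 0
    \<and> fps_nth (fps_expansion lune_h 0) 5 =
        complex_of_real (1 / 20 * (69 / 136 + sqrt 69 / (4 * sqrt 17)))
    \<and> norm (H21_log lune_h) = 23 / 3264"
proof -
  have sqrt_68: "sqrt 68 = 2 * sqrt (17::real)"
    using real_sqrt_mult[of 4 17] by simp
  have k: "sqrt (69 / 68) = sqrt 69 / (2 * sqrt (17::real))"
    by (simp add: real_sqrt_divide sqrt_68)
  have k2: "(complex_of_real (sqrt (69 / 68)))\<^sup>2 = complex_of_real (69 / 68)"
    unfolding of_real_power[symmetric] by simp
  have a3: "fps_nth (fps_expansion lune_h 0) 3 = complex_of_real (sqrt 69 / (12 * sqrt 17))"
    unfolding lune_h_coeffs k by simp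
  have a5: "fps_nth (fps_expansion lune_h 0) 5 =
      complex_of_real (1 / 20 * (69 / 136 + sqrt 69 / (4 * sqrt 17)))"
    unfolding lune_h_coeffs k2 unfolding k by (simp add: field_simps)
  \<comment> \<open>As a2 = a4 = 0, only -12 a3^2 = -k^2/3 remains; k^2 = 69/68 is exactly the value
    that makes its modulus 23/68.\<close>
  have "48 * H21_log lune_h = - 12 * (complex_of_real (sqrt (69 / 68)) / 6)\<^sup>2"
    unfolding H21_log_eq[OF lune_h_class_S] lune_h_coeffs by simp
  also have "\<dots> = - (23 / 68)"
    unfolding power_divide k2 by simp
  finally have "norm (48 * H21_log lune_h) = 23 / 68"
    by (simp add: norm_divide)
  then have "norm (H21_log lune_h) = 23 / 3264"
    by (simp add: norm_mult)
  with a3 a5 show ?thesis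
    using norm_H21_log_C_lune_le norm_H21_log_C_lune_attained lune_h_class_S lune_h_coeffs(1,3)
    by blast
qed

end
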